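(* Let $n\ge 1$ and let $a_1,\dots,a_n$ be pairwise relatively prime positive integers. Let $$\mathcal P=\Big\{(x_1,\dots,x_n)\in\mathbb R^n : x_k\ge 0 \text{ for all } k,\ \sum_{k=1}^n a_kx_k\le 1\Big\},$$ and for a positive integer $t$ let $L(\overline{\mathcal P},t)=\#(t\mathcal P\cap\mathbb Z^n)$ be the number of lattice points in $t\mathcal P=\{tx: x\in\mathcal P\}$. Then for every positive integer $t$, $$L(\overline{\mathcal P},t)=R_{-t}(a_1,\dots,a_n)+(-1)^n\sum_{j=1}^n\sigma_{-t}(a_1,\dots,\hat a_j,\dots,a_n,1;a_j),$$ where $\hat a_j$ means that the entry $a_j$ is omitted, and $R_{-t}(a_1,\dots,a_n)=-\operatorname{Res}(F_{-t}(z),z=1)$ with $$F_{-t}(z)=\frac{z^{-t-1}}{(1-z^{a_1})\cdots(1-z^{a_n})(1-z)}.$$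
   Context: Fourier-Dedekind sum: for integers $c_1,\dots,c_m$ each relatively prime to a positive integer $c$, and $t\in\mathbb Z$, $$\sigma_t(c_1,\dots,c_m;c)=\frac1c\sum_{\lambda^c=1,\ \lambda\ne1}\frac{\lambda^t}{(\lambda^{c_1}-1)\cdots(\lambda^{c_m}-1)},$$ the sum being over all complex $c$-th roots of unity $\lambda\neq 1$ (so it is $0$ if $c=1$). $\operatorname{Res}(F(z),z=1)$ denotes the residue of the meromorphic function $F$ at $z=1$. *)

theory Defs
  imports "HOL-Complex_Analysis.Complex_Analysis" "HOL-Library.Multiset"
begin

(* The sum is symmetric in c_1, ..., c_m, so these are collected (with repetitions)
   in a multiset.  The definition is meant for c > 0 and every element of C coprime
   to c; only then are all denominators nonzero. *)
definition fourier_dedekind :: "int \<Rightarrow> int multiset \<Rightarrow> nat \<Rightarrow> complex" where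
  "fourier_dedekind t C c =
     1 / of_nat c *
     (\<Sum>w | w ^ c = 1 \<and> w \<noteq> 1. (w powi t) / (\<Prod>d\<in>#C. (w powi d - 1)))"

definition polytope_P :: "('n::finite \<Rightarrow> nat) \<Rightarrow> (real ^ 'n) set" where
  "polytope_P a = {x. (\<forall>k. 0 \<le> x $ k) \<and> (\<Sum>k\<in>UNIV. real (a k) * x $ k) \<le> 1}"

definition integer_points :: "(real ^ 'n::finite) set" where
  "integer_points = {x. \<forall>k. x $ k \<in> \<int>}"

definition lattice_count :: "(real ^ 'n::finite) set \<Rightarrow> nat \<Rightarrow> nat" where
  "lattice_count P t = card ((\<lambda>x. real t *\<^sub>R x) ` P \<inter> integer_points)"

definition gen_F :: "int \<Rightarrow> ('n::finite \<Rightarrow> nat) \<Rightarrow> complex \<Rightarrow> complex" where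
  "gen_F s a z = (z powi (s - 1)) / ((\<Prod>k\<in>UNIV. 1 - z ^ a k) * (1 - z))"

definition res_R :: "int \<Rightarrow> ('n::finite \<Rightarrow> nat) \<Rightarrow> complex" where
  "res_R s a = - residue (gen_F s a) 1"

end

theory Submission
  imports Defs
begin

text \<open>
  The residues of \<open>F(z) = z\<^sup>-\<^sup>t\<^sup>-\<^sup>1 / ((1 - z\<^bsup>a\<^sub>1\<^esup>) \<dots> (1 - z\<^bsup>a\<^sub>n\<^esup>) (1 - z))\<close>
  add up to zero. The residue at 0 is the coefficient of \<open>z\<^sup>t\<close> in the generating function of the
  numbers of solutions of \<open>a\<^sub>1 x\<^sub>1 + \<dots> + a\<^sub>n x\<^sub>n \<le> t\<close>, the factor \<open>1 / (1 - z)\<close> supplying the slack.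
  By coprimality every root of unity other than 1 is a pole for at most one \<open>a\<^sub>j\<close>, hence simple, and
  these poles produce the Fourier-Dedekind sums.
\<close>

section \<open>Generating function of the bounded solutions\<close>

text \<open>Setting \<open>f\<close> to 0 off \<open>S\<close> makes solutions for different index
  sets comparable: those for \<open>S\<close> are exactly the solutions for
  \<open>insert k S\<close> with \<open>f k = 0\<close>.\<close>

definition bounded_solutions :: "('a \<Rightarrow> nat) \<Rightarrow> 'a set \<Rightarrow> nat \<Rightarrow> ('a \<Rightarrow> nat) set" where
  "bounded_solutions a S n = {f. (\<forall>k. k \<notin> S \<longrightarrow> f k = 0) \<and> (\<Sum>k\<in>S. a k * f k) \<le> n}"

lemma bounded_solutions_empty [simp]: "bounded_solutions a {} n = {\<lambda>_. 0}"
  by (auto simp: bounded_solutions_def)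

lemma finite_bounded_solutions:
  assumes "finite S" "\<And>k. a k > 0"
  shows "finite (bounded_solutions a S n)"
proof (rule finite_subset)
  show "bounded_solutions a S n \<subseteq> {f. \<forall>k. (k \<in> S \<longrightarrow> f k \<in> {..n}) \<and> (k \<notin> S \<longrightarrow> f k = 0)}"
  proof (intro subsetI, clarsimp simp: bounded_solutions_def)
    fix f k assume le: "(\<Sum>k\<in>S. a k * f k) \<le> n" and "k \<in> S"
    then have "a k * f k \<le> n"
      using member_le_sum[of k S "\<lambda>k. a k * f k"] assms by fastforce
    moreover have "f k \<le> a k * f k"
      using assms(2)[of k] by (cases "a k") auto
    ultimately show "f k \<le> n" by linarith
  qed
  show "finite {f. \<forall>k. (k \<in> S \<longrightarrow> f k \<in> {..n}) \<and> (k \<notin> S \<longrightarrow> f k = 0)}"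
    using finite_set_of_finite_funs[OF assms(1) finite_atMost[of n], of 0] by simp
qed

text \<open>Split by whether \<open>f k\<close> vanishes. If it does not, lowering
  \<open>f k\<close> by one is a bijection onto the solutions with bound \<open>n - a k\<close>; the
  guard \<open>a k \<le> n\<close> keeps this subtraction from truncating. The recursion is
  multiplication by \<open>1 - fps_X ^ a k\<close>, read off coefficientwise.\<close>

lemma card_bounded_solutions_insert:
  assumes "finite S" "k \<notin> S" "\<And>k. a k > 0"
  shows "card (bounded_solutions a (insert k S) n) =
    card (bounded_solutions a S n) +
    (if a k \<le> n then card (bounded_solutions a (insert k S) (n - a k)) else 0)"
proof -
  let ?B = "\<lambda>n. bounded_solutions a (insert k S) n"
  let ?up = "\<lambda>f. f(k := Suc (f k))"
  have sum_upd: "(\<Sum>i\<in>S. a i * (if i = k then v else f i)) = (\<Sum>i\<in>S. a i * f i)" for f v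
    using assms(2) by (intro sum.cong) auto
  have zero: "bounded_solutions a S n = {f \<in> ?B n. f k = 0}"
  proof (intro set_eqI iffI)
    fix f assume "f \<in> bounded_solutions a S n"
    then show "f \<in> {f \<in> ?B n. f k = 0}"
      using assms(1,2) by (auto simp: bounded_solutions_def)
  next
    fix f assume f: "f \<in> {f \<in> ?B n. f k = 0}"
    then have "f i = 0" if "i \<notin> S" for i
      using that by (cases "i = k") (auto simp: bounded_solutions_def)
    then show "f \<in> bounded_solutions a S n"
      using f assms(1,2) by (simp add: bounded_solutions_def)
  qed
  have pos: "{f \<in> ?B n. f k \<noteq> 0} = (if a k \<le> n then ?up ` ?B (n - a k) else {})"
  proof (intro set_eqI iffI)
    fix f assume f: "f \<in> {f \<in> ?B n. f k \<noteq> 0}"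
    then obtain m where m: "f k = Suc m"
      using not0_implies_Suc by blast
    have le: "a k * f k + (\<Sum>i\<in>S. a i * f i) \<le> n"
      using f assms(1,2) by (simp add: bounded_solutions_def)
    then have ak: "a k \<le> n"
      by (simp add: m)
    define g where "g = f(k := m)"
    have "(\<Sum>i\<in>insert k S. a i * g i) \<le> n - a k"
      using assms(1,2) le m by (simp add: g_def sum_upd)
    moreover have "g i = 0" if "i \<notin> insert k S" for i
      using f that by (simp add: g_def bounded_solutions_def)
    ultimately have "g \<in> ?B (n - a k)"
      by (simp add: bounded_solutions_def)
    moreover have "f = ?up g"
      using m by (auto simp: g_def)
    ultimately have "f \<in> ?up ` ?B (n - a k)"
      by (intro image_eqI[where x = g])
    then show "f \<in> (if a k \<le> n then ?up ` ?B (n - a k) else {})"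
      using ak by simp
  next
    fix f assume "f \<in> (if a k \<le> n then ?up ` ?B (n - a k) else {})"
    then show "f \<in> {f \<in> ?B n. f k \<noteq> 0}"
      using assms(1,2) by (auto simp: bounded_solutions_def sum_upd split: if_splits)
  qed
  have inj: "inj ?up"
  proof (rule injI)
    fix f g assume eq: "?up f = ?up g"
    show "f = g"
    proof
      fix i show "f i = g i"
        using fun_cong[OF eq, of i] by (cases "i = k") auto
    qed
  qed
  have fin: "finite (?B n)"
    using assms by (intro finite_bounded_solutions) auto
  have "card (?B n) = card ({f \<in> ?B n. f k = 0} \<union> {f \<in> ?B n. f k \<noteq> 0})"
    by (rule arg_cong[of _ _ card]) auto
  also have "\<dots> = card {f \<in> ?B n. f k = 0} + card {f \<in> ?B n. f k \<noteq> 0}"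
    using fin by (intro card_Un_disjoint) auto
  finally show ?thesis
    unfolding zero pos using inj by (auto simp: card_image inj_on_subset)
qed

text \<open>Each new index contributes one factor of the denominator by the counting recursion. The
  product form avoids division, so any commutative ring will do.\<close>

lemma fps_bounded_solutions:
  assumes "finite S" "\<And>k. a k > 0"
  shows "Abs_fps (\<lambda>n. of_nat (card (bounded_solutions a S n))) *
    ((\<Prod>k\<in>S. 1 - fps_X ^ a k) * (1 - fps_X)) = (1 :: 'b :: comm_ring_1 fps)"
  using assms(1)
proof (induction S rule: finite_induct)
  case empty
  \<comment> \<open>With no variables every coefficient is 1, which is the geometric series for
    \<open>1 / (1 - fps_X)\<close>.\<close>
  show ?case
    by (rule fps_ext) (simp add: right_diff_distrib)
next
  case (insert k S)
  let ?H = "\<lambda>S. Abs_fps (\<lambda>n. of_nat (card (bounded_solutions a S n))) :: 'b fps"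
  have "?H (insert k S) * (1 - fps_X ^ a k) = ?H S"
    using card_bounded_solutions_insert[of S k a] insert.hyps assms(2)
    by (intro fps_ext) (simp add: right_diff_distrib fps_X_power_mult_right_nth)
  then have "?H (insert k S) * ((\<Prod>i\<in>insert k S. 1 - fps_X ^ a i) * (1 - fps_X)) =
      ?H S * ((\<Prod>i\<in>S. 1 - fps_X ^ a i) * (1 - fps_X))"
    using insert.hyps by (simp add: mult.assoc[symmetric])
  then show ?case
    using insert.IH by simp
qed

section \<open>Lattice points of the dilated polytope\<close>

text \<open>Substituting \<open>y = t x\<close> turns the bound 1 into \<open>t\<close>, and an
  integral point with nonnegative coordinates is the image of a function into the naturals.
  Positivity of \<open>t\<close> allows \<open>x\<close> to be recovered as
  \<open>y / t\<close>.\<close>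

lemma lattice_count_polytope_P:
  fixes a :: "'n::finite \<Rightarrow> nat"
  assumes "t > 0"
  shows "lattice_count (polytope_P a) t = card (bounded_solutions a UNIV t)"
proof -
  let ?v = "\<lambda>f::'n \<Rightarrow> nat. (\<chi> k. real (f k)) :: real ^ 'n"
  have "(\<lambda>x. real t *\<^sub>R x) ` polytope_P a \<inter> integer_points = ?v ` bounded_solutions a UNIV t"
  proof (intro set_eqI iffI)
    fix y assume y: "y \<in> (\<lambda>x. real t *\<^sub>R x) ` polytope_P a \<inter> integer_points"
    then obtain x where x: "y = real t *\<^sub>R x" "x \<in> polytope_P a" by blast
    have int: "y $ k \<in> \<int>" for k
      using y by (simp add: integer_points_def)
    have nonneg: "y $ k \<ge> 0" for k
      using x by (simp add: polytope_P_def)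
    define f where "f k = nat \<lfloor>y $ k\<rfloor>" for k
    have f: "real (f k) = y $ k" for k
      using int[of k] nonneg[of k] by (auto simp: f_def Ints_def)
    have "real (\<Sum>k\<in>UNIV. a k * f k) = real t * (\<Sum>k\<in>UNIV. real (a k) * x $ k)"
      by (simp add: f x(1) sum_distrib_left mult_ac)
    also have "\<dots> \<le> real t"
      using x(2) by (simp add: polytope_P_def mult_left_le)
    finally have "f \<in> bounded_solutions a UNIV t"
      unfolding bounded_solutions_def of_nat_le_iff by simp
    moreover have "y = ?v f"
      by (simp add: vec_eq_iff f)
    ultimately show "y \<in> ?v ` bounded_solutions a UNIV t" by blast
  next
    fix y assume "y \<in> ?v ` bounded_solutions a UNIV t"
    then obtain f where f: "y = ?v f" "(\<Sum>k\<in>UNIV. a k * f k) \<le> t"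
      by (auto simp: bounded_solutions_def)
    have "real (\<Sum>k\<in>UNIV. a k * f k) \<le> real t"
      using f(2) by (simp only: of_nat_le_iff)
    then have "(\<Sum>k\<in>UNIV. real (a k) * (real (f k) / real t)) \<le> 1"
      using assms by (simp add: sum_divide_distrib[symmetric] divide_le_eq)
    then have "(1 / real t) *\<^sub>R y \<in> polytope_P a"
      using assms by (simp add: polytope_P_def f(1))
    moreover have "y = real t *\<^sub>R ((1 / real t) *\<^sub>R y)"
      using assms by simp
    ultimately have "y \<in> (\<lambda>x. real t *\<^sub>R x) ` polytope_P a" by blast
    then show "y \<in> (\<lambda>x. real t *\<^sub>R x) ` polytope_P a \<inter> integer_points"
      by (simp add: f(1) integer_points_def)
  qed
  moreover have "inj ?v"
    by (auto simp: inj_def vec_eq_iff fun_eq_iff)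
  ultimately show ?thesis
    unfolding lattice_count_def by (simp add: card_image inj_on_subset)
qed

section \<open>The residue at 0\<close>

text \<open>The residue at 0 of \<open>G z / z ^ Suc t\<close>, with \<open>G\<close> analytic
  there, is the Taylor coefficient of \<open>G\<close> at index \<open>t\<close>; here
  \<open>G\<close> expands to the series of the counts.\<close>

lemma residue_gen_F_0:
  fixes a :: "'n::finite \<Rightarrow> nat"
  assumes "\<And>k. a k > 0"
  shows "residue (gen_F (- int t) a) 0 = of_nat (card (bounded_solutions a UNIV t))"
proof -
  define D :: "complex fps" where "D = (\<Prod>k\<in>UNIV. 1 - fps_X ^ a k) * (1 - fps_X)"
  define H :: "complex fps" where
    "H = Abs_fps (\<lambda>n. of_nat (card (bounded_solutions a UNIV n)))"
  have HD: "H * D = 1"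
    unfolding H_def D_def using assms by (intro fps_bounded_solutions) auto
  then have inv: "inverse D = H"
    by (intro fps_inverse_unique) (simp add: mult.commute)
  \<comment> \<open>The constant term of \<open>D\<close> is a factor of the constant term of
    \<open>H * D = 1\<close>, hence nonzero, so the expansion of \<open>D\<close> may be
    inverted.\<close>
  have "fps_nth (H * D) 0 = 1"
    unfolding HD by simp
  then have D0: "fps_nth D 0 \<noteq> 0"
    by auto
  have "(\<lambda>z. (\<Prod>k\<in>UNIV. 1 - z ^ a k) * (1 - z)) has_fps_expansion D"
    unfolding D_def by (intro fps_expansion_intros)
  then have "(\<lambda>z. inverse ((\<Prod>k\<in>UNIV. 1 - z ^ a k) * (1 - z))) has_fps_expansion H"
    using D0 unfolding inv[symmetric] by (rule has_fps_expansion_inverse)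
  then have "residue (\<lambda>z. inverse ((\<Prod>k\<in>UNIV. 1 - z ^ a k) * (1 - z)) / z ^ Suc t) 0 = fps_nth H t"
    by (rule residue_fps_expansion_over_power_at_0)
  moreover have "gen_F (- int t) a =
      (\<lambda>z. inverse ((\<Prod>k\<in>UNIV. 1 - z ^ a k) * (1 - z)) / z ^ Suc t)"
  proof
    \<comment> \<open>The equality also holds at \<open>z = 0\<close>, where both sides are 0
      because division by zero gives 0.\<close>
    fix z :: complex
    have "- int t - 1 = - int (Suc t)" by simp
    then show "gen_F (- int t) a z = inverse ((\<Prod>k\<in>UNIV. 1 - z ^ a k) * (1 - z)) / z ^ Suc t"
      unfolding gen_F_def by (simp only: power_int_minus power_int_of_nat divide_inverse mult.commute)
  qed
  ultimately show ?thesis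
    by (simp add: H_def)
qed

section \<open>Simple poles at the nontrivial roots of unity\<close>

text \<open>Bezout in the form \<open>m * x = n * y + 1\<close> over the naturals, so that
  \<open>w\<close> need not be invertible. This is what keeps a root of unity other than 1 from
  being a zero of two factors of the denominator.\<close>

lemma power_eq_1_coprime:
  fixes w :: "'a :: monoid_mult"
  assumes "w ^ m = 1" "w ^ n = 1" "coprime m n" "m > 0"
  shows "w = 1"
proof -
  obtain d x y where d: "d dvd m" "d dvd n" "m * x = n * y + d"
    using bezout_add_strong_nat[of m n] assms(4) by blast
  moreover have "d = 1"
    using coprime_common_divisor_nat[OF assms(3) d(1,2)] .
  ultimately have "w ^ (m * x) = w ^ (n * y) * w"
    by (simp add: power_add power_commutes)
  then have "(w ^ m) ^ x = (w ^ n) ^ y * w"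
    by (simp only: power_mult)
  then show ?thesis
    using assms by simp
qed

text \<open>Only the factor \<open>1 - z ^ a j\<close> vanishes at \<open>w\<close>, and to first
  order. Writing the function as \<open>f / g\<close> with this factor as \<open>g\<close>, the
  residue is \<open>f w\<close> divided by the derivative of \<open>g\<close> at
  \<open>w\<close>.\<close>

lemma residue_gen_F_simple_pole:
  fixes a :: "'n::finite \<Rightarrow> nat" and w :: complex
  assumes a: "\<And>k. a k > 0" and cop: "\<And>i. i \<noteq> j \<Longrightarrow> coprime (a i) (a j)"
    and w: "w ^ a j = 1" "w \<noteq> 1"
  shows "residue (gen_F s a) w =
    - (w powi s) / (of_nat (a j) * ((\<Prod>k\<in>UNIV - {j}. 1 - w ^ a k) * (1 - w)))"
proof -
  define D where "D z = (\<Prod>k\<in>UNIV - {j}. 1 - z ^ a k) * (1 - z)" for z :: complex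
  define f where "f z = z powi (s - 1) / D z" for z
  define g where "g z = 1 - z ^ a j" for z :: complex
  have w0: "w \<noteq> 0"
    using w(1) a[of j] by (auto simp: power_0_left)
  have "w ^ a i \<noteq> 1" if "i \<noteq> j" for i
    using power_eq_1_coprime[of w "a i" "a j"] cop[OF that] w a[of i] by auto
  then have Dw: "D w \<noteq> 0"
    using w(2) by (auto simp: D_def)
  have F: "gen_F s a = (\<lambda>z. f z / g z)"
  proof
    fix z :: complex
    have "(\<Prod>k\<in>UNIV. 1 - z ^ a k) = g z * (\<Prod>k\<in>UNIV - {j}. 1 - z ^ a k)"
      unfolding g_def by (rule prod.remove) auto
    then show "gen_F s a z = f z / g z"
      unfolding gen_F_def f_def D_def by (simp only: divide_divide_eq_left mult_ac)
  qed
  \<comment> \<open>The extra factor \<open>z\<close> makes the ball found below avoid 0 as well,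
    where \<open>z powi (s - 1)\<close> may have a pole.\<close>
  have "continuous_on UNIV (\<lambda>z. z * D z)"
    unfolding D_def by (intro continuous_intros)
  then have "open {z. z * D z \<noteq> 0}"
    by (rule open_Collect_neq) (rule continuous_on_const)
  moreover have "w \<in> {z. z * D z \<noteq> 0}"
    using w0 Dw by simp
  ultimately obtain r where r: "r > 0" "ball w r \<subseteq> {z. z * D z \<noteq> 0}"
    by (rule openE)
  have D_hol: "D holomorphic_on A" for A
    unfolding D_def by (intro holomorphic_intros)
  have "f holomorphic_on ball w r"
    unfolding f_def using r by (intro holomorphic_intros D_hol) auto
  moreover have "g holomorphic_on ball w r"
    unfolding g_def by (intro holomorphic_intros)
  moreover have "(g has_field_derivative (- of_nat (a j) * w ^ (a j - 1))) (at w)"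
    unfolding g_def by (auto intro!: derivative_eq_intros)
  moreover have "f w \<noteq> 0" "g w = 0" "- of_nat (a j) * w ^ (a j - 1) \<noteq> 0"
    using a[of j] w w0 Dw by (auto simp: f_def g_def)
  ultimately have "residue (\<lambda>z. f z / g z) w = f w / (- of_nat (a j) * w ^ (a j - 1))"
    using r(1) by (intro residue_simple_pole_deriv[where s = "ball w r"]) auto
  also have "\<dots> = - (w powi (s - 1) / w ^ (a j - 1)) / (of_nat (a j) * D w)"
    by (simp add: f_def mult_ac)
  \<comment> \<open>Since \<open>w ^ a j = 1\<close>, the power \<open>w ^ (a j - 1)\<close> is the
    inverse of \<open>w\<close>, and dividing by it raises the exponent by one.\<close>
  also have "w powi (s - 1) / w ^ (a j - 1) = w powi s"
  proof -
    have "w * w ^ (a j - 1) = 1"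
      using w(1) a[of j] power_minus_mult[of "a j" w] by (simp add: mult.commute)
    then have "w ^ (a j - 1) = inverse w"
      by (rule inverse_unique[symmetric])
    then show ?thesis
      using w0 by (simp add: power_int_diff)
  qed
  finally show ?thesis
    unfolding F D_def .
qed

section \<open>Decay at infinity and the vanishing residue sum\<close>

text \<open>For \<open>norm z \<ge> 2\<close> every factor of the denominator has modulus at least
  1, and \<open>t \<ge> 1\<close> makes the numerator at most \<open>1 / norm z ^ 2\<close>.\<close>

lemma norm_gen_F_le:
  fixes a :: "'n::finite \<Rightarrow> nat" and z :: complex
  assumes "\<And>k. a k > 0" "t > 0" "norm z \<ge> 2"
  shows "norm (gen_F (- int t) a z) \<le> 1 / norm z ^ 2"
proof -
  have ge1: "norm (1 - z ^ m) \<ge> 1" if "m > 0" for m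
  proof -
    have "norm z \<le> norm z ^ m"
      using assms(3) that by (intro self_le_power) auto
    moreover have "norm (z ^ m) - norm (1::complex) \<le> norm (1 - z ^ m)"
      by (metis norm_minus_commute norm_triangle_ineq2)
    ultimately show ?thesis
      using assms(3) by (simp add: norm_power)
  qed
  have "1 \<le> (\<Prod>k\<in>UNIV. norm (1 - z ^ a k))"
    using ge1 assms(1) by (intro prod_ge_1) auto
  moreover have "1 \<le> norm (1 - z)"
    using ge1[of 1] by simp
  ultimately have "1 \<le> (\<Prod>k\<in>UNIV. norm (1 - z ^ a k)) * norm (1 - z)"
    by (metis mult_mono' mult_1 zero_le_one)
  then have D: "1 \<le> norm ((\<Prod>k\<in>UNIV. 1 - z ^ a k) * (1 - z))"
    by (simp add: norm_mult prod_norm)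
  have "norm z ^ 2 \<le> norm z ^ Suc t"
    using assms(2,3) by (intro power_increasing) auto
  then have N: "norm (z powi (- int t - 1)) \<le> 1 / norm z ^ 2"
  proof -
    have eq: "- int t - 1 = - int (Suc t)" by simp
    have pos: "0 < norm z ^ 2" using assms(3) by auto
    have "norm (z powi (- int t - 1)) = 1 / norm z ^ Suc t"
      unfolding eq by (simp only: power_int_minus power_int_of_nat norm_inverse norm_power)
        (simp only: inverse_eq_divide)
    also have "\<dots> \<le> 1 / norm z ^ 2"
      using \<open>norm z ^ 2 \<le> norm z ^ Suc t\<close> pos by (intro divide_left_mono) (auto intro: mult_pos_pos)
    finally show ?thesis .
  qed
  show ?thesis
    unfolding gen_F_def norm_divide
    using frac_le[OF _ N _ D] by simp
qed

lemma finite_nontrivial_roots_unity: "m > 0 \<Longrightarrow> finite {w :: complex. w ^ m = 1 \<and> w \<noteq> 1}"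
  by (rule finite_subset[OF _ finite_roots_unity[of m]]) auto

lemma norm_root_unity:
  fixes w :: complex
  assumes "w ^ m = 1" "m > 0"
  shows "norm w = 1"
  using assms by (metis norm_ge_zero norm_one norm_power power_eq_1_iff not_gr_zero)

text \<open>The function is \<open>O(1/|z|\<^sup>2)\<close> at infinity, so its integrals over large circles tend to 0.\<close>
lemma sum_residues_gen_F:
  fixes a :: "'n::finite \<Rightarrow> nat"
  assumes a: "\<And>k. a k > 0" and t: "t > 0"
  defines "P \<equiv> insert 0 (insert 1 (\<Union>j. {w. w ^ a j = 1 \<and> w \<noteq> 1}))"
  shows "(\<Sum>p\<in>P. residue (gen_F (- int t) a) p) = 0"
proof -
  let ?F = "gen_F (- int t) a"
  define S where "S = (\<Sum>p\<in>P. residue ?F p)"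
  have fin: "finite P"
    using a by (auto simp: P_def intro: finite_nontrivial_roots_unity)
  have norm_P: "norm p \<le> 1" if "p \<in> P" for p
    using that a norm_root_unity by (fastforce simp: P_def)
  have hol: "?F holomorphic_on UNIV - P"
    unfolding gen_F_def by (intro holomorphic_intros) (auto simp: P_def)
  have bound: "norm S \<le> 1 / R" if R: "R \<ge> 2" for R
  proof -
    have path: "path_image (circlepath 0 R) \<subseteq> UNIV - P"
      using R norm_P by fastforce
    have "contour_integral (circlepath 0 R) ?F =
        2 * pi * \<i> * (\<Sum>p\<in>P. winding_number (circlepath 0 R) p * residue ?F p)"
      using fin hol path by (intro Residue_theorem[of UNIV]) auto
    \<comment> \<open>All of \<open>P\<close> lies in the closed unit disc, so a circle of radius at
      least 2 winds once around each point.\<close>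
    also have "(\<Sum>p\<in>P. winding_number (circlepath 0 R) p * residue ?F p) = S"
      unfolding S_def
    proof (intro sum.cong refl)
      fix p assume "p \<in> P"
      then have "winding_number (circlepath 0 R) p = 1"
        using norm_P[of p] R by (intro winding_number_circlepath) auto
      then show "winding_number (circlepath 0 R) p * residue ?F p = residue ?F p" by simp
    qed
    finally have int: "contour_integral (circlepath 0 R) ?F = 2 * pi * \<i> * S" .
    have "?F contour_integrable_on circlepath 0 R"
      using hol path holomorphic_on_imp_continuous_on holomorphic_on_subset
      by (intro contour_integrable_continuous_circlepath) blast
    then have "(?F has_contour_integral 2 * pi * \<i> * S) (circlepath 0 R)"
      by (metis has_contour_integral_integral int)
    then have "norm (2 * pi * \<i> * S) \<le> 1 / R ^ 2 * (2 * pi * R)"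
    proof (rule has_contour_integral_bound_circlepath)
      fix z :: complex assume "norm (z - 0) = R"
      then show "norm (?F z) \<le> 1 / R ^ 2"
        using norm_gen_F_le[of a t z] a t R by simp
    qed (use R in auto)
    then have "2 * pi * norm S \<le> 2 * pi * (1 / R)"
      using R by (simp add: norm_mult power2_eq_square)
    then show ?thesis
      using mult_le_cancel_left_pos[of "2 * pi" "norm S" "1 / R"] pi_gt_zero by simp
  qed
  have "S = 0"
  proof (rule ccontr)
    assume "S \<noteq> 0"
    \<comment> \<open>Chosen so that \<open>R \<ge> 2\<close> while
      \<open>norm S * R = 2 * norm S + 2\<close> exceeds 1, against the bound.\<close>
    define R where "R = 2 + 2 / norm S"
    have R: "R \<ge> 2" by (simp add: R_def)
    have "norm S * R \<le> 1"
      using bound[OF R] R by (simp add: le_divide_eq)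
    moreover have "norm S * R = 2 * norm S + 2"
      using \<open>S \<noteq> 0\<close> by (simp add: R_def algebra_simps)
    ultimately show False
      using norm_ge_zero[of S] by linarith
  qed
  then show ?thesis by (simp add: S_def)
qed

section \<open>Fourier-Dedekind sums and the conclusion\<close>

text \<open>The two sums agree term by term up to sign. Turning \<open>w ^ a k - 1\<close> into
  \<open>1 - w ^ a k\<close> for \<open>k \<noteq> j\<close>, and \<open>w - 1\<close> into
  \<open>1 - w\<close> for the entry 1, costs \<open>CARD('n)\<close> signs; one further sign comes
  from the derivative of \<open>1 - z ^ a j\<close>.\<close>

lemma sum_residue_eq_fourier_dedekind:
  fixes a :: "'n::finite \<Rightarrow> nat"
  assumes "\<And>k. a k > 0" "\<And>i. i \<noteq> j \<Longrightarrow> coprime (a i) (a j)"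
  shows "(\<Sum>w | w ^ a j = 1 \<and> w \<noteq> 1. residue (gen_F s a) w) =
    - ((-1) ^ CARD('n) * fourier_dedekind s
         (add_mset 1 (image_mset (\<lambda>k. int (a k)) (mset_set (UNIV - {j})))) (a j))"
proof -
  have sign: "(\<Prod>k\<in>UNIV - {j}. w ^ a k - 1) * (w - 1) =
      (-1) ^ CARD('n) * ((\<Prod>k\<in>UNIV - {j}. 1 - w ^ a k) * (1 - w))" for w :: complex
  proof -
    have "(\<Prod>k\<in>UNIV - {j}. w ^ a k - 1) = (\<Prod>k\<in>UNIV - {j}. (-1) * (1 - w ^ a k))"
      by simp
    also have "\<dots> = (-1) ^ (CARD('n) - 1) * (\<Prod>k\<in>UNIV - {j}. 1 - w ^ a k)"
      by (subst prod.distrib) (simp add: card_Diff_singleton)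
    finally have "(\<Prod>k\<in>UNIV - {j}. w ^ a k - 1) * (w - 1) =
        ((-1) ^ (CARD('n) - 1) * (-1)) * ((\<Prod>k\<in>UNIV - {j}. 1 - w ^ a k) * (1 - w))"
      by (simp add: algebra_simps)
    also have "(-1) ^ (CARD('n) - 1) * (-1) = (-1 :: complex) ^ CARD('n)"
      by (rule power_minus_mult) simp
    finally show ?thesis .
  qed
  have "fourier_dedekind s (add_mset 1 (image_mset (\<lambda>k. int (a k)) (mset_set (UNIV - {j})))) (a j) =
      1 / of_nat (a j) * (\<Sum>w | w ^ a j = 1 \<and> w \<noteq> 1.
        w powi s / ((-1) ^ CARD('n) * ((\<Prod>k\<in>UNIV - {j}. 1 - w ^ a k) * (1 - w))))"
    unfolding fourier_dedekind_def sign[symmetric]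
    by (simp add: image_mset.compositionality comp_def prod_unfold_prod_mset mult.commute)
  also have "\<dots> = (\<Sum>w | w ^ a j = 1 \<and> w \<noteq> 1. - ((-1) ^ CARD('n) * residue (gen_F s a) w))"
    unfolding sum_distrib_left
  proof (intro sum.cong refl)
    fix w :: complex assume "w \<in> {w. w ^ a j = 1 \<and> w \<noteq> 1}"
    then have res: "residue (gen_F s a) w =
        - (w powi s) / (of_nat (a j) * ((\<Prod>k\<in>UNIV - {j}. 1 - w ^ a k) * (1 - w)))"
      using assms by (intro residue_gen_F_simple_pole) auto
    then show "1 / of_nat (a j) *
        (w powi s / ((-1) ^ CARD('n) * ((\<Prod>k\<in>UNIV - {j}. 1 - w ^ a k) * (1 - w)))) =
        - ((-1) ^ CARD('n) * residue (gen_F s a) w)"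
      \<comment> \<open>A power of -1 is its own inverse, so the sign moves from denominator to
        numerator.\<close>
      unfolding res by (simp add: minus_one_power_iff)
  qed
  also have "\<dots> = - ((-1) ^ CARD('n) * (\<Sum>w | w ^ a j = 1 \<and> w \<noteq> 1. residue (gen_F s a) w))"
    by (simp only: sum_negf sum_distrib_left)
  finally show ?thesis
    by (simp add: minus_one_power_iff)
qed

theorem theorem1:
  fixes a :: "'n::finite \<Rightarrow> nat" and t :: nat
  assumes "\<And>k. a k > 0"
    and "\<And>i j. i \<noteq> j \<Longrightarrow> coprime (a i) (a j)"
    and "t > 0"
  shows "of_nat (lattice_count (polytope_P a) t) =
    res_R (- int t) a +
    (-1) ^ CARD('n) *
      (\<Sum>j\<in>UNIV. fourier_dedekind (- int t)
         (add_mset 1 (image_mset (\<lambda>k. int (a k)) (mset_set (UNIV - {j})))) (a j))"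
proof -
  let ?A = "\<lambda>j. {w :: complex. w ^ a j = 1 \<and> w \<noteq> 1}"
  let ?res = "residue (gen_F (- int t) a)"
  have fin: "finite (?A j)" for j
    using assms(1) by (rule finite_nontrivial_roots_unity)
  \<comment> \<open>Disjointness lets the sum over all nontrivial roots split into one sum for each
    \<open>j\<close>, with no pole counted twice.\<close>
  have disj: "?A i \<inter> ?A j = {}" if "i \<noteq> j" for i j
    using power_eq_1_coprime assms(1,2) that by blast
  have notin: "0 \<notin> insert 1 (\<Union>j. ?A j)" "1 \<notin> (\<Union>j. ?A j)"
    using assms(1) by (auto simp: power_0_left)
  have "0 = ?res 0 + (?res 1 + (\<Sum>w\<in>(\<Union>j. ?A j). ?res w))"
    using sum_residues_gen_F[of a t] assms(1,3) notin fin by simp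
  also have "(\<Sum>w\<in>(\<Union>j. ?A j). ?res w) = (\<Sum>j\<in>UNIV. \<Sum>w\<in>?A j. ?res w)"
    using fin disj by (intro sum.UNION_disjoint) auto
  also have "\<dots> = (\<Sum>j\<in>UNIV. - ((-1) ^ CARD('n) * fourier_dedekind (- int t)
         (add_mset 1 (image_mset (\<lambda>k. int (a k)) (mset_set (UNIV - {j})))) (a j)))"
    using assms(1,2) by (intro sum.cong refl sum_residue_eq_fourier_dedekind) auto
  finally have "0 = ?res 0 + (?res 1 - (-1) ^ CARD('n) *
      (\<Sum>j\<in>UNIV. fourier_dedekind (- int t)
         (add_mset 1 (image_mset (\<lambda>k. int (a k)) (mset_set (UNIV - {j})))) (a j)))"
    by (simp add: sum_negf sum_distrib_left)
  \<comment> \<open>The residue at 0 supplies the lattice count, and the residue at 1 is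
    \<open>- res_R (- int t) a\<close>.\<close>
  moreover have "?res 0 = of_nat (lattice_count (polytope_P a) t)"
    using residue_gen_F_0[of a t] assms(1,3) by (simp add: lattice_count_polytope_P)
  ultimately show ?thesis
    unfolding res_R_def by (simp add: algebra_simps)
qed

end
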